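(* Let $\ell=(i_1,\dots,i_l)$ be a finite nonempty ordered collection of positive integers, and define $\tilde\varphi_\ell(n)=\tilde\varphi_{i_1}(n)\cdots\tilde\varphi_{i_l}(n)$ for $n\in\mathbb{N}$. Then the limit $\lim_{n\to\infty}\frac{1}{n}\sum_{m=1}^n\tilde\varphi_\ell(m)$ exists and equals $\prod_p f_\ell\!\left(\frac{1}{p}\right)$, where $f_\ell(t)=1-t\left(1-\prod_{j=1}^l(1-t^{i_j})\right)$.
   Context: For a positive integer $k$, $\tilde\varphi_k:\mathbb{N}\to\mathbb{R}$ is defined by $\tilde\varphi_k(p_1^{l_1}\cdots p_m^{l_m})=\prod_{r=1}^m\left(1-\frac{1}{p_r^k}\right)$, where $p_1,\dots,p_m$ are pairwise distinct primes and $l_r\ge1$ (so $\tilde\varphi_k(1)=1$). $\prod_p$ denotes the product over all primes. *)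

theory Defs
  imports "HOL-Analysis.Analysis" "HOL-Computational_Algebra.Primes"
begin

text \<open>Only positive arguments matter; the junk value at 0 is 1, as \<open>prime_factors 0 = {}\<close>.\<close>

definition phi_tilde :: "nat \<Rightarrow> nat \<Rightarrow> real" where
  "phi_tilde k n = (\<Prod>p\<in>prime_factors n. 1 - 1 / real p ^ k)"

lemma phi_tilde_prod_prime_powers:
  assumes "finite P" "\<And>p. p \<in> P \<Longrightarrow> prime p" "\<And>p. p \<in> P \<Longrightarrow> l p \<ge> 1"
  shows "phi_tilde k (\<Prod>p\<in>P. p ^ l p) = (\<Prod>p\<in>P. 1 - 1 / real p ^ k)"
proof -
  have "0 \<notin> (\<lambda>p. p ^ l p) ` P"
    using assms(2) by (metis imageE not_prime_0 power_eq_0_iff)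
  then have "prime_factors (\<Prod>p\<in>P. p ^ l p) = (\<Union>p\<in>P. prime_factors (p ^ l p))"
    using assms(1) by (subst prime_factors_prod) auto
  also have "\<dots> = (\<Union>p\<in>P. {p})"
    using assms by (intro SUP_cong) (auto simp: prime_factorization_prime_power Suc_le_eq)
  finally show ?thesis
    by (simp add: phi_tilde_def)
qed

definition phi_tilde_list :: "nat list \<Rightarrow> nat \<Rightarrow> real" where
  "phi_tilde_list js n = (\<Prod>j\<leftarrow>js. phi_tilde j n)"

definition f_list :: "nat list \<Rightarrow> real \<Rightarrow> real" where
  "f_list js t = 1 - t * (1 - (\<Prod>j\<leftarrow>js. 1 - t ^ j))"

text \<open>
  A product over all primes, in increasing order, is the infinite product of this sequence:
  non-primes contribute a factor 1.
\<close>

definition on_primes :: "(nat \<Rightarrow> real) \<Rightarrow> nat \<Rightarrow> real" where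
  "on_primes g n = (if prime n then g n else 1)"

end

theory Submission
  imports Defs
begin

text \<open>
  Write the summand as \<open>\<Prod>p | m. 1 - a p\<close> with \<open>0 \<le> a p \<le> C / p\<close>. Keeping only the primes
  \<open>p \<le> N\<close> changes the mean over \<open>m \<le> n\<close> by at most
  \<open>\<Sum>p>N. (C / p) (1 / p)\<close>, uniformly in \<open>n\<close>. The truncated product expands into a finite combination
  of indicators of \<open>d dvd m\<close>, each of mean value \<open>1 / d\<close>, so its mean value is
  \<open>\<Prod>p\<le>N. 1 - a p / p\<close>.
\<close>

lemma card_multiples_upto:
  fixes n d :: nat
  assumes "d > 0"
  shows "card {m \<in> {1..n}. d dvd m} = n div d"
proof -
  have "{m \<in> {1..n}. d dvd m} = (*) d ` {1..n div d}"
  proof (intro equalityI subsetI)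
    fix m assume m: "m \<in> {m \<in> {1..n}. d dvd m}"
    then obtain k where k: "m = d * k" by (auto elim: dvdE)
    with m assms have "k \<in> {1..n div d}"
      by (auto simp: less_eq_div_iff_mult_less_eq mult.commute Suc_le_eq)
    with k show "m \<in> (*) d ` {1..n div d}" by blast
  qed (use assms in \<open>auto simp: less_eq_div_iff_mult_less_eq mult.commute Suc_le_eq\<close>)
  moreover have "inj_on ((*) d) {1..n div d}"
    using assms by (auto intro: inj_onI)
  ultimately show ?thesis
    by (simp add: card_image)
qed

lemma sum_indicator_dvd:
  fixes n d :: nat
  assumes "d > 0"
  shows "(\<Sum>m=1..n. of_bool (d dvd m) :: real) = real (n div d)"
proof -
  have "(\<Sum>m=1..n. of_bool (d dvd m) :: real) = real (card {m \<in> {1..n}. d dvd m})"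
    by (simp add: of_bool_def sum.If_cases Int_def)
  then show ?thesis
    using card_multiples_upto[OF assms] by simp
qed

text \<open>At \<open>n = 0\<close> the left side is 0, because \<open>1 / real 0 = 0\<close>. The
  bound thus holds for every n, and this makes the later truncation error uniform in n.\<close>

lemma mean_indicator_dvd_le:
  fixes n d :: nat
  assumes "d > 0"
  shows "(1 / real n) * (\<Sum>m=1..n. of_bool (d dvd m)) \<le> 1 / real d"
proof (cases "n = 0")
  case False
  then show ?thesis
    unfolding sum_indicator_dvd[OF assms]
    using of_nat_div_le_of_nat[of n d, where 'a = real] by (simp add: field_simps)
qed simp

lemma mean_indicator_dvd_tendsto:
  fixes d :: nat
  assumes "d > 0"
  shows "(\<lambda>n. (1 / real n) * (\<Sum>m=1..n. of_bool (d dvd m))) \<longlonglongrightarrow> 1 / real d"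
proof (rule tendsto_sandwich)
  show "\<forall>\<^sub>F n in sequentially. 1 / real d - 1 / real n
      \<le> (1 / real n) * (\<Sum>m=1..n. of_bool (d dvd m))"
    using eventually_gt_at_top[of 0]
  proof eventually_elim
    case (elim n)
    \<comment> \<open>The rounding loss is (n mod d) / d < 1; after division by n it becomes the
      error 1/n of the lower bound.\<close>
    have "real n / real d - 1 \<le> real (n div d)"
      using of_nat_of_nat_div_aux[of n d, where 'a = real] mod_less_divisor[OF assms, of n] assms
      by (simp add: divide_less_eq)
    then have "(1 / real n) * (real n / real d - 1) \<le> (1 / real n) * real (n div d)"
      by (intro mult_left_mono) auto
    with elim show ?case
      unfolding sum_indicator_dvd[OF assms] by (simp add: algebra_simps)
  qed
  show "(\<lambda>n. 1 / real d - 1 / real n) \<longlonglongrightarrow> 1 / real d"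
    using tendsto_diff[OF tendsto_const lim_1_over_n] by simp
qed (use mean_indicator_dvd_le[OF assms] in auto)

text \<open>Distinct primes are coprime, so their separate divisibilities combine. This merges a
  product of indicators into a single one, whose mean value is already known.\<close>

lemma prod_primes_dvd_iff:
  fixes X :: "nat set" and m :: nat
  assumes "finite X" "\<And>p. p \<in> X \<Longrightarrow> prime p"
  shows "\<Prod>X dvd m \<longleftrightarrow> (\<forall>p\<in>X. p dvd m)"
  using assms
proof (induction X)
  case (insert q X)
  then have "coprime q (\<Prod>X)"
    by (intro prod_coprime_right) (auto intro!: primes_coprime)
  then have "q * \<Prod>X dvd m \<longleftrightarrow> q dvd m \<and> \<Prod>X dvd m"
    by (auto intro: divides_mult dest: dvd_mult_left dvd_mult_right)
  with insert show ?case by simp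
qed simp

lemma mean_value_finite_prime_product:
  fixes a :: "nat \<Rightarrow> real"
  assumes "finite A" "\<And>p. p \<in> A \<Longrightarrow> prime p"
  shows "(\<lambda>n. (1 / real n) * (\<Sum>m=1..n. \<Prod>p\<in>A. 1 - a p * of_bool (p dvd m)))
      \<longlonglongrightarrow> (\<Prod>p\<in>A. 1 - a p / real p)"
proof -
  \<comment> \<open>Used twice: with \<open>b p = a p * of_bool (p dvd m)\<close> to open the
    product under the mean, and with \<open>b p = a p / real p\<close> to fold the limit back into a
    product.\<close>
  have expand: "(\<Prod>p\<in>A. 1 - b p) = (\<Sum>X\<in>Pow A. \<Prod>p\<in>X. - b p)" for b :: "nat \<Rightarrow> real"
    using prod_add[OF assms(1), of "\<lambda>p. - b p" "\<lambda>_. 1"] by simp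
  have indicator: "(\<Prod>p\<in>X. - (a p * of_bool (p dvd m))) = (\<Prod>p\<in>X. - a p) * of_bool (\<Prod>X dvd m)"
    if "X \<in> Pow A" for X m
  proof -
    have "finite X" "\<And>p. p \<in> X \<Longrightarrow> prime p"
      using that assms finite_subset by auto
    moreover from this(1) have "(\<Prod>p\<in>X. of_bool (p dvd m) :: real) = of_bool (\<forall>p\<in>X. p dvd m)"
      by (induction X) auto
    ultimately have "(\<Prod>p\<in>X. - a p * of_bool (p dvd m)) = (\<Prod>p\<in>X. - a p) * of_bool (\<Prod>X dvd m)"
      by (simp only: prod.distrib prod_primes_dvd_iff)
    then show ?thesis
      by (simp only: mult_minus_left)
  qed
  have "(\<lambda>n. (1 / real n) * (\<Sum>m=1..n. \<Prod>p\<in>A. 1 - a p * of_bool (p dvd m)))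
      = (\<lambda>n. \<Sum>X\<in>Pow A. (\<Prod>p\<in>X. - a p) * ((1 / real n) * (\<Sum>m=1..n. of_bool (\<Prod>X dvd m))))"
  proof
    fix n
    have "(\<Sum>m=1..n. \<Prod>p\<in>A. 1 - a p * of_bool (p dvd m))
        = (\<Sum>m=1..n. \<Sum>X\<in>Pow A. (\<Prod>p\<in>X. - a p) * of_bool (\<Prod>X dvd m))"
      unfolding expand by (intro sum.cong refl indicator)
    also have "\<dots> = (\<Sum>X\<in>Pow A. (\<Prod>p\<in>X. - a p) * (\<Sum>m=1..n. of_bool (\<Prod>X dvd m)))"
      unfolding sum_distrib_left by (rule sum.swap)
    finally show "(1 / real n) * (\<Sum>m=1..n. \<Prod>p\<in>A. 1 - a p * of_bool (p dvd m))
        = (\<Sum>X\<in>Pow A. (\<Prod>p\<in>X. - a p) * ((1 / real n) * (\<Sum>m=1..n. of_bool (\<Prod>X dvd m))))"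
      by (simp add: sum_distrib_left mult_ac)
  qed
  moreover have "\<dots> \<longlonglongrightarrow> (\<Sum>X\<in>Pow A. (\<Prod>p\<in>X. - a p) * (1 / real (\<Prod>X)))"
  proof (intro tendsto_sum tendsto_mult tendsto_const mean_indicator_dvd_tendsto)
    fix X assume "X \<in> Pow A"
    with assms show "0 < \<Prod>X"
      by (intro prod_pos) (auto simp: prime_gt_0_nat)
  qed
  moreover have "(\<Sum>X\<in>Pow A. (\<Prod>p\<in>X. - a p) * (1 / real (\<Prod>X))) = (\<Prod>p\<in>A. 1 - a p / real p)"
    unfolding expand
    by (intro sum.cong refl) (simp only: minus_divide_left prod_dividef of_nat_prod, simp)
  ultimately show ?thesis by simp
qed

text \<open>The difference is the product over \<open>A\<close>, which lies in [0,1], times 1 minus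
  the product over \<open>B\<close>; the Weierstrass product inequality bounds the second factor by
  \<open>sum a B\<close>.\<close>

lemma prod_diff_union_bounds:
  fixes a :: "'a \<Rightarrow> real"
  assumes "finite A" "finite B" "A \<inter> B = {}" "\<And>x. x \<in> A \<union> B \<Longrightarrow> 0 \<le> a x \<and> a x \<le> 1"
  shows "\<bar>(\<Prod>x\<in>A \<union> B. 1 - a x) - (\<Prod>x\<in>A. 1 - a x)\<bar> \<le> sum a B"
proof -
  have A: "0 \<le> (\<Prod>x\<in>A. 1 - a x)" "(\<Prod>x\<in>A. 1 - a x) \<le> 1"
    using assms(4) by (auto intro!: prod_nonneg prod_le_1)
  have B: "(\<Prod>x\<in>B. 1 - a x) \<le> 1"
    using assms(4) by (auto intro!: prod_le_1)
  have "1 - sum a B \<le> (\<Prod>x\<in>B. 1 - a x)"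
    using assms(4) by (intro Weierstrass_prod_ineq) auto
  then have "1 - (\<Prod>x\<in>B. 1 - a x) \<le> sum a B"
    by simp
  then have "(\<Prod>x\<in>A. 1 - a x) * (1 - (\<Prod>x\<in>B. 1 - a x)) \<le> 1 * sum a B"
    using A B by (intro mult_mono) auto
  moreover have "\<bar>(\<Prod>x\<in>A \<union> B. 1 - a x) - (\<Prod>x\<in>A. 1 - a x)\<bar>
      = (\<Prod>x\<in>A. 1 - a x) * (1 - (\<Prod>x\<in>B. 1 - a x))"
    using A B assms(1-3)
    by (simp add: prod.union_disjoint abs_minus_commute right_diff_distrib
        abs_of_nonneg mult_left_le)
  ultimately show ?thesis by simp
qed

text \<open>An interchange of limits: since \<open>e N\<close> does not depend on n, N can be fixed
  first, and |F n - l| splits into three parts, each below r/3.\<close>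

lemma tendsto_of_uniform_approx:
  fixes F :: "nat \<Rightarrow> real"
  assumes "\<And>N. G N \<longlonglongrightarrow> L N" "L \<longlonglongrightarrow> l" "e \<longlonglongrightarrow> 0"
    and "\<And>N n. \<bar>F n - G N n\<bar> \<le> e N"
  shows "F \<longlonglongrightarrow> l"
proof (rule LIMSEQ_I)
  fix r :: real assume "r > 0"
  then have "\<forall>\<^sub>F N in sequentially. \<bar>L N - l\<bar> < r / 3 \<and> e N < r / 3"
    using tendstoD[OF assms(2), of "r / 3"] order_tendstoD(2)[OF assms(3), of "r / 3"]
    by (simp add: dist_real_def eventually_conj_iff)
  then obtain N where N: "\<bar>L N - l\<bar> < r / 3" "e N < r / 3"
    using eventually_happens'[OF sequentially_bot] by blast
  obtain n0 where n0: "\<bar>G N n - L N\<bar> < r / 3" if "n \<ge> n0" for n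
    using LIMSEQ_D[OF assms(1), of "r / 3" N] \<open>r > 0\<close> by auto
  then have "norm (F n - l) < r" if "n \<ge> n0" for n
    using N assms(4)[of n N] n0[OF that] unfolding real_norm_def by linarith
  then show "\<exists>no. \<forall>n\<ge>no. norm (F n - l) < r" by blast
qed

lemma summable_divide_square: "summable (\<lambda>k. C / real k ^ 2)"
  using summable_mult[OF inverse_power_summable[of 2, where 'a = real], of C]
  by (simp add: divide_inverse)

lemma mean_prime_product_truncation:
  fixes a :: "nat \<Rightarrow> real"
  assumes "\<And>p. prime p \<Longrightarrow> 0 \<le> a p \<and> a p \<le> 1"
    and bound: "\<And>p. prime p \<Longrightarrow> a p \<le> C / real p"
    and "C \<ge> 0"
  shows "\<bar>(1 / real n) * (\<Sum>m=1..n. \<Prod>p\<in>prime_factors m. 1 - a p)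
      - (1 / real n) * (\<Sum>m=1..n. \<Prod>p | prime p \<and> p \<le> N. 1 - a p * of_bool (p dvd m))\<bar>
    \<le> (\<Sum>k. C / real (k + Suc N) ^ 2)"
proof -
  \<comment> \<open>Cutting \<open>?T\<close> off at n keeps it finite and loses nothing, as prime
    factors of m \<le> n are at most n.\<close>
  let ?S = "{p. prime p \<and> p \<le> N}" and ?T = "{p. prime p \<and> N < p \<and> p \<le> n}"
  let ?D = "\<lambda>m. (\<Prod>p\<in>prime_factors m. 1 - a p) - (\<Prod>p\<in>?S. 1 - a p * of_bool (p dvd m))"
  have pointwise: "\<bar>?D m\<bar> \<le> (\<Sum>p\<in>?T. C / real p * of_bool (p dvd m))" if "m \<in> {1..n}" for m
  proof -
    let ?A = "{p \<in> ?S. p dvd m}" and ?B = "{p \<in> ?T. p dvd m}"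
    have "prime_factors m = ?A \<union> ?B"
      using that by (auto simp: prime_factors_dvd dest: dvd_imp_le)
    moreover have "(\<Prod>p\<in>?S. 1 - a p * of_bool (p dvd m)) = (\<Prod>p\<in>?A. 1 - a p)"
      by (rule prod.mono_neutral_cong_right) auto
    moreover have "\<bar>(\<Prod>p\<in>?A \<union> ?B. 1 - a p) - (\<Prod>p\<in>?A. 1 - a p)\<bar> \<le> sum a ?B"
      using assms(1) by (intro prod_diff_union_bounds) auto
    ultimately have "\<bar>?D m\<bar> \<le> sum a ?B"
      by simp
    also have "\<dots> \<le> (\<Sum>p\<in>?B. C / real p)"
      using bound by (intro sum_mono) auto
    also have "\<dots> = (\<Sum>p\<in>?T. C / real p * of_bool (p dvd m))"
      by (rule sum.mono_neutral_cong_left) auto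
    finally show ?thesis .
  qed
  have "\<bar>(1 / real n) * (\<Sum>m=1..n. \<Prod>p\<in>prime_factors m. 1 - a p)
      - (1 / real n) * (\<Sum>m=1..n. \<Prod>p\<in>?S. 1 - a p * of_bool (p dvd m))\<bar>
    = (1 / real n) * \<bar>\<Sum>m=1..n. ?D m\<bar>"
    by (simp add: sum_subtractf abs_mult flip: right_diff_distrib diff_divide_distrib)
  also have "\<dots> \<le> (1 / real n) * (\<Sum>m=1..n. \<Sum>p\<in>?T. C / real p * of_bool (p dvd m))"
    by (intro mult_left_mono order_trans[OF sum_abs] sum_mono pointwise) auto
  \<comment> \<open>Grouping by primes instead of by m exposes the frequency of the multiples of p,
    at most 1/p. Together with the weight C/p this gives the summable C/p^2.\<close>
  also have "\<dots> = (\<Sum>p\<in>?T. C / real p * ((1 / real n) * (\<Sum>m=1..n. of_bool (p dvd m))))"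
    unfolding sum_distrib_left by (subst sum.swap) (simp only: mult_ac)
  also have "\<dots> \<le> (\<Sum>p\<in>?T. C / real p * (1 / real p))"
    using \<open>C \<ge> 0\<close> by (intro sum_mono mult_left_mono mean_indicator_dvd_le) (auto simp: prime_gt_0_nat)
  also have "\<dots> = (\<Sum>p\<in>?T. C / real p ^ 2)"
    by (simp add: power2_eq_square)
  \<comment> \<open>Every p in \<open>?T\<close> is at least \<open>Suc N\<close>, so the truncated
    subtraction is injective there. The sum becomes part of a tail over all integers, which is
    independent of n.\<close>
  also have "\<dots> = (\<Sum>k\<in>(\<lambda>p. p - Suc N) ` ?T. C / real (k + Suc N) ^ 2)"
    by (subst sum.reindex) (auto intro!: inj_onI sum.cong)
  also have "\<dots> \<le> (\<Sum>k. C / real (k + Suc N) ^ 2)"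
  proof (rule sum_le_suminf)
    show "summable (\<lambda>k. C / real (k + Suc N) ^ 2)"
      using summable_ignore_initial_segment[OF summable_divide_square] .
  qed (use \<open>C \<ge> 0\<close> in auto)
  finally show ?thesis .
qed

theorem mean_value_prime_product:
  fixes a :: "nat \<Rightarrow> real"
  assumes a01: "\<And>p. prime p \<Longrightarrow> 0 \<le> a p \<and> a p \<le> 1"
    and bound: "\<And>p. prime p \<Longrightarrow> a p \<le> C / real p"
    and "C \<ge> 0"
  defines "g \<equiv> on_primes (\<lambda>p. 1 - a p / real p)"
  shows "convergent_prod g"
    and "(\<lambda>n. (1 / real n) * (\<Sum>m=1..n. \<Prod>p\<in>prime_factors m. 1 - a p)) \<longlonglongrightarrow> prodinf g"
proof -
  \<comment> \<open>At a prime, |g p - 1| = a p / p; elsewhere, including p = 0, it is 0. Absolute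
    convergence of the product follows from summability of C/p^2.\<close>
  have "norm (norm (g p - 1)) \<le> C / real p ^ 2" for p
    using a01[of p] divide_right_mono[OF bound[of p], of "real p"] \<open>C \<ge> 0\<close>
    by (auto simp: g_def on_primes_def power2_eq_square)
  then have "summable (\<lambda>p. norm (g p - 1))"
    by (intro summable_comparison_test'[OF summable_divide_square])
  then show conv: "convergent_prod g"
    by (intro abs_convergent_prod_imp_convergent_prod summable_imp_abs_convergent_prod)
  have truncate: "(\<Prod>p\<le>N. g p) = (\<Prod>p | prime p \<and> p \<le> N. 1 - a p / real p)" for N
    unfolding g_def on_primes_def by (intro prod.mono_neutral_cong_right) auto
  show "(\<lambda>n. (1 / real n) * (\<Sum>m=1..n. \<Prod>p\<in>prime_factors m. 1 - a p)) \<longlonglongrightarrow> prodinf g"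
  proof (rule tendsto_of_uniform_approx[where
        G = "\<lambda>N n. (1 / real n) * (\<Sum>m=1..n. \<Prod>p | prime p \<and> p \<le> N. 1 - a p * of_bool (p dvd m))"
        and L = "\<lambda>N. \<Prod>p | prime p \<and> p \<le> N. 1 - a p / real p"
        and e = "\<lambda>N. \<Sum>k. C / real (k + Suc N) ^ 2"])
    show "(\<lambda>N. \<Prod>p | prime p \<and> p \<le> N. 1 - a p / real p) \<longlonglongrightarrow> prodinf g"
      using convergent_prod_LIMSEQ[OF conv] by (simp add: truncate)
    show "(\<lambda>N. \<Sum>k. C / real (k + Suc N) ^ 2) \<longlonglongrightarrow> 0"
      using suminf_exist_split2[OF summable_divide_square] by (rule LIMSEQ_Suc)
    show "(\<lambda>n. (1 / real n) * (\<Sum>m=1..n. \<Prod>p | prime p \<and> p \<le> N. 1 - a p * of_bool (p dvd m)))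
        \<longlonglongrightarrow> (\<Prod>p | prime p \<and> p \<le> N. 1 - a p / real p)" for N
      by (rule mean_value_finite_prime_product) auto
  qed (rule mean_prime_product_truncation[OF a01 bound \<open>C \<ge> 0\<close>])
qed

text \<open>The third bound supplies the constant C. With P the product over the tail, 1 - (1 - t^j)
  P = (1 - P) + t^j P, so each entry adds at most t^j \<le> t, where j \<ge> 1 enters.\<close>

lemma prod_list_one_minus_power_bounds:
  fixes t :: real
  assumes "0 \<le> t" "t \<le> 1" "\<forall>j\<in>set js. j \<ge> 1"
  shows "0 \<le> (\<Prod>j\<leftarrow>js. 1 - t ^ j)" "(\<Prod>j\<leftarrow>js. 1 - t ^ j) \<le> 1"
    and "1 - (\<Prod>j\<leftarrow>js. 1 - t ^ j) \<le> real (length js) * t"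
proof -
  have "0 \<le> (\<Prod>j\<leftarrow>js. 1 - t ^ j) \<and> (\<Prod>j\<leftarrow>js. 1 - t ^ j) \<le> 1 \<and>
      1 - (\<Prod>j\<leftarrow>js. 1 - t ^ j) \<le> real (length js) * t"
    using assms(3)
  proof (induction js)
    case (Cons j js)
    let ?P = "\<Prod>j\<leftarrow>js. 1 - t ^ j"
    from Cons have IH: "0 \<le> ?P" "?P \<le> 1" "1 - ?P \<le> real (length js) * t"
      by auto
    have tj: "0 \<le> t ^ j" "t ^ j \<le> 1" "t ^ j \<le> t"
      using assms(1,2) Cons.prems power_decreasing[of 1 j t] by (auto simp: power_le_one)
    have "t ^ j * ?P \<le> t"
      using mult_mono[of "t ^ j" t ?P 1] tj IH assms(1) by simp
    moreover have "0 \<le> (1 - t ^ j) * ?P" "(1 - t ^ j) * ?P \<le> 1"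
      using tj IH by (auto intro!: mult_nonneg_nonneg mult_le_one)
    ultimately show ?case
      using tj IH by (simp add: algebra_simps)
  qed simp
  then show "0 \<le> (\<Prod>j\<leftarrow>js. 1 - t ^ j)" "(\<Prod>j\<leftarrow>js. 1 - t ^ j) \<le> 1"
    and "1 - (\<Prod>j\<leftarrow>js. 1 - t ^ j) \<le> real (length js) * t" by auto
qed

lemma phi_tilde_list_eq_prod:
  "phi_tilde_list js n = (\<Prod>p\<in>prime_factors n. \<Prod>j\<leftarrow>js. 1 - (1 / real p) ^ j)"
  unfolding phi_tilde_list_def
  by (induction js) (auto simp: phi_tilde_def prod.distrib power_one_over)

theorem theorem2:
  fixes js :: "nat list"
  assumes "js \<noteq> []" and "\<forall>j\<in>set js. j \<ge> 1"
  shows "convergent_prod (on_primes (\<lambda>p. f_list js (1 / real p))) \<and>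
    (\<lambda>n. (1 / real n) * (\<Sum>m=1..n. phi_tilde_list js m))
      \<longlonglongrightarrow> prodinf (on_primes (\<lambda>p. f_list js (1 / real p)))"
proof -
  \<comment> \<open>With this choice 1 - a p is the factor of \<open>phi_tilde_list js\<close> at p,
    and 1 - a p / p is \<open>f_list js (1 / real p)\<close>.\<close>
  define a where "a p = 1 - (\<Prod>j\<leftarrow>js. 1 - (1 / real p) ^ j)" for p
  have a: "0 \<le> a p \<and> a p \<le> 1" "a p \<le> real (length js) / real p" if "prime p" for p
    using prod_list_one_minus_power_bounds[of "1 / real p" js] assms(2) prime_gt_0_nat[OF that]
    by (auto simp: a_def)
  have "(\<lambda>p. f_list js (1 / real p)) = (\<lambda>p. 1 - a p / real p)"
    by (simp add: f_list_def a_def fun_eq_iff)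
  moreover have "phi_tilde_list js = (\<lambda>m. \<Prod>p\<in>prime_factors m. 1 - a p)"
    by (simp add: phi_tilde_list_eq_prod a_def fun_eq_iff)
  ultimately show ?thesis
    using mean_value_prime_product[of a "real (length js)"] a by simp
qed

end
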